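(* Let $u:(0,\infty)\to\mathbb{R}$ be a utility function with reasonable asymptotic elasticity, and let $(\Omega,\Sigma)$ be a measurable space. Then for any probability measures $\mu,\nu$ on $(\Omega,\Sigma)$ such that $\mu\ll\nu$, $$\Delta_u(\mu,\nu)=N_u(\nu\parallel\mu),\qquad \delta_u(\mu,\nu)=e^{H_u(\nu\parallel\mu)}-1.$$
   Context: A utility function is a strictly concave, strictly increasing, continuously differentiable function $u:(0,\infty)\to\mathbb{R}$ such that $\lim_{x\searrow 0}u'(x)=\infty$ and $\lim_{x\nearrow\infty}u'(x)=0$. Put $u(0):=\lim_{x\searrow0}u(x)$ and $u(\infty):=\lim_{x\nearrow\infty}u(x)$. Reasonable asymptotic elasticity means $\limsup_{x\nearrow\infty}\frac{x u'(x)}{u(x)}<1$. Conventions: $\infty\cdot 0=-\infty\cdot 0=0$, $u^{-1}(u(\infty)):=\infty$, $\ln\infty=\infty$, $e^{\infty}=\infty$. The convex dual $u^*:(0,\infty)\to\mathbb{R}$ is $u^*(y):=\sup_{x>0}(u(x)-yx)$, with $u^*(0):=\lim_{y\searrow0}u^*(y)=u(\infty)$ and $u^*(\infty):=\lim_{y\nearrow\infty}u^*(y)=u(0)$. For a probability measure $\mu$ on $(\Omega,\Sigma)$, $D(\mu)$ is the set of all densities $w\in L^1(\mu)$, that is, $w\geq 0$ and $\int_\Omega w\,d\mu=1$ (regarded as actual functions on $\Omega$, not $\mu$-a.e. equivalence classes). For probability measures $\nu,\mu$ on $(\Omega,\Sigma)$ put $\mathcal{A}(\nu,\mu):=\{w\in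 D(\mu): u(w)^{-}\in L^{1}(\nu)\}$, where $x^-=\max(-x,0)$, $$N_u(\nu\parallel\mu):=\sup_{w\in\mathcal{A}(\nu,\mu)}\int_\Omega u(w)\,d\nu,\qquad H_u(\nu\parallel\mu):=\ln u^{-1}(N_u(\nu\parallel\mu)).$$ For $\mu\ll\nu$ put $$\Delta_u(\mu,\nu):=\sup_{\Lambda>0}\left(\Lambda+\int_\Omega u^*\!\left(\Lambda\frac{d\mu}{d\nu}\right)d\nu\right),\qquad \delta_u(\mu,\nu):=u^{-1}(\Delta_u(\mu,\nu))-1$$ (the Frittelli generalised distance).
   Formalization: In the definition of Δ_u the supremum over Λ>0 is replaced by an infimum, since the printed supremum is always +∞ (e.g. u=ln, μ=ν gives sup(Λ−ln Λ−1)=∞ while N_u=0). *)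

theory Defs
  imports "HOL-Probability.Probability"
begin

definition strictly_concave_on :: "real set \<Rightarrow> (real \<Rightarrow> real) \<Rightarrow> bool" where
  "strictly_concave_on S f \<longleftrightarrow> convex S \<and>
     (\<forall>x\<in>S. \<forall>y\<in>S. \<forall>t. x \<noteq> y \<longrightarrow> 0 < t \<longrightarrow> t < 1 \<longrightarrow>
        (1 - t) * f x + t * f y < f ((1 - t) * x + t * y))"

text \<open>Functions on the open half-line are total functions of which only the restriction to
  \<^term>\<open>{0<..} :: real set\<close> is used.\<close>

definition utility_function :: "(real \<Rightarrow> real) \<Rightarrow> bool" where
  "utility_function u \<longleftrightarrow>
     strictly_concave_on {0<..} u \<and>
     strict_mono_on {0<..} u \<and>
     (\<forall>x>0. u differentiable (at x)) \<and> continuous_on {0<..} (deriv u) \<and>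
     filterlim (deriv u) at_top (at_right 0) \<and>
     (deriv u \<longlongrightarrow> 0) at_top"

definition reasonable_asymptotic_elasticity :: "(real \<Rightarrow> real) \<Rightarrow> bool" where
  "reasonable_asymptotic_elasticity u \<longleftrightarrow>
     Limsup at_top (\<lambda>x. ereal (x * deriv u x / u x)) < 1"

text \<open>Extension of a function on the open half-line to $[0,\infty]$ by its one-sided limits, which
  exist as extended reals for the monotone functions considered here. Arguments below 0 are
  irrelevant.\<close>

definition extend_by_limits :: "(real \<Rightarrow> real) \<Rightarrow> ereal \<Rightarrow> ereal" where
  "extend_by_limits f x =
     (if x = 0 then Lim (at_right 0) (\<lambda>t. ereal (f t))
      else if x = \<infinity> then Lim at_top (\<lambda>t. ereal (f t))
      else ereal (f (real_of_ereal x)))"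

text \<open>For a utility function \<open>u\<close> and \<open>y > 0\<close> the supremum is that of a nonempty set of reals
  bounded above, because the derivative of \<open>u\<close> tends to 0 at infinity.\<close>

definition convex_dual :: "(real \<Rightarrow> real) \<Rightarrow> real \<Rightarrow> real" where
  "convex_dual u y = (SUP x\<in>{0<..}. u x - y * x)"

text \<open>The inverse of \<open>u\<close>, extended to $[0,\infty]$. This covers the convention that the inverse maps
  $u(\infty)$ to $\infty$, whether or not $u(\infty)$ is finite.\<close>

definition utility_inverse :: "(real \<Rightarrow> real) \<Rightarrow> ereal \<Rightarrow> ereal" where
  "utility_inverse u = the_inv_into {0..} (extend_by_limits u)"

text \<open>Integral of an extended real valued function, meaningful when the positive or the negative
  part has a finite integral; \<^const>\<open>e2ennreal\<close> truncates negative values to 0.\<close>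

definition ereal_integral :: "'a measure \<Rightarrow> ('a \<Rightarrow> ereal) \<Rightarrow> ereal" where
  "ereal_integral M f =
     enn2ereal (\<integral>\<^sup>+x. e2ennreal (f x) \<partial>M) - enn2ereal (\<integral>\<^sup>+x. e2ennreal (- f x) \<partial>M)"

definition ereal_integrable :: "'a measure \<Rightarrow> ('a \<Rightarrow> ereal) \<Rightarrow> bool" where
  "ereal_integrable M f \<longleftrightarrow>
     f \<in> borel_measurable M \<and> (\<integral>\<^sup>+x. e2ennreal \<bar>f x\<bar> \<partial>M) < \<infinity>"

text \<open>Logarithm on $[0,\infty]$ and exponential on $[-\infty,\infty]$.\<close>

definition ln_ereal :: "ereal \<Rightarrow> ereal" where
  "ln_ereal x =
     (if x = \<infinity> then \<infinity> else if x \<le> 0 then -\<infinity> else ereal (ln (real_of_ereal x)))"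

definition exp_ereal :: "ereal \<Rightarrow> ereal" where
  "exp_ereal x =
     (if x = \<infinity> then \<infinity> else if x = -\<infinity> then 0 else ereal (exp (real_of_ereal x)))"

definition densities :: "'a measure \<Rightarrow> ('a \<Rightarrow> real) set" where
  "densities \<mu> =
     {w. integrable \<mu> w \<and> (\<forall>x\<in>space \<mu>. 0 \<le> w x) \<and> (\<integral>x. w x \<partial>\<mu>) = 1}"

definition admissible :: "(real \<Rightarrow> real) \<Rightarrow> 'a measure \<Rightarrow> 'a measure \<Rightarrow> ('a \<Rightarrow> real) set" where
  "admissible u \<nu> \<mu> =
     {w \<in> densities \<mu>. ereal_integrable \<nu> (\<lambda>x. max (- extend_by_limits u (ereal (w x))) 0)}"

definition N_util :: "(real \<Rightarrow> real) \<Rightarrow> 'a measure \<Rightarrow> 'a measure \<Rightarrow> ereal" where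
  "N_util u \<nu> \<mu> =
     (SUP w\<in>admissible u \<nu> \<mu>. ereal_integral \<nu> (\<lambda>x. extend_by_limits u (ereal (w x))))"

definition H_util :: "(real \<Rightarrow> real) \<Rightarrow> 'a measure \<Rightarrow> 'a measure \<Rightarrow> ereal" where
  "H_util u \<nu> \<mu> = ln_ereal (utility_inverse u (N_util u \<nu> \<mu>))"

text \<open>Frittelli's generalised distance is defined by a minimisation over the multiplier $\Lambda$.
  A supremum, as printed in the source, has to be read as an infimum: for \<open>u = ln\<close> and
  \<open>\<mu> = \<nu>\<close> the expression below is $\Lambda - \ln\Lambda - 1$, which is unbounded above, whereas its
  infimum 0 is the value of \<^const>\<open>N_util\<close>. Note that \<^term>\<open>RN_deriv \<nu> \<mu>\<close> is the density of \<open>\<mu>\<close>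
  with respect to \<open>\<nu>\<close>.\<close>

definition Delta_util :: "(real \<Rightarrow> real) \<Rightarrow> 'a measure \<Rightarrow> 'a measure \<Rightarrow> ereal" where
  "Delta_util u \<mu> \<nu> =
     (INF \<Lambda>\<in>{0<..}. ereal \<Lambda> +
        ereal_integral \<nu>
          (\<lambda>x. extend_by_limits (convex_dual u) (ereal \<Lambda> * enn2ereal (RN_deriv \<nu> \<mu> x))))"

definition delta_util :: "(real \<Rightarrow> real) \<Rightarrow> 'a measure \<Rightarrow> 'a measure \<Rightarrow> ereal" where
  "delta_util u \<mu> \<nu> = utility_inverse u (Delta_util u \<mu> \<nu>) - 1"

end

theory Submission
  imports Defs
begin

text \<open>Fenchel's inequality \<open>u(w) \<le> u\<^sup>*(\<Lambda> Z) + \<Lambda> Z w\<close>, with \<open>Z\<close> the density of \<open>\<mu>\<close> with respect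
  to \<open>\<nu>\<close>, gives \<open>N \<le> \<Delta>\<close>. Conversely, if \<open>N\<close> is finite, the concave value of the problem as a function
  of the budget has a supporting line at budget 1, of some slope \<open>L \<ge> 0\<close>. For \<open>\<Lambda> > L\<close> the integral
  of \<open>u\<^sup>*(\<Lambda> Z)\<close> is, by monotone convergence, the supremum of the integrals of \<open>u(w) - \<Lambda> Z w\<close> over
  functions \<open>w\<close> with finitely many positive values, because the supremum defining \<open>u\<^sup>*\<close> may be
  restricted to a countable dense set. Each of these is at most \<open>N - L\<close>, so \<open>\<Delta> \<le> N + (\<Lambda> - L)\<close>.
  The second identity holds because \<open>N\<close> lies between \<open>u(1)\<close> and \<open>u(\<infinity>)\<close>, hence in the range of \<open>u\<close>.\<close>

section \<open>Integrals of extended real valued functions\<close>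

lemma ereal_integral_cong_AE:
  assumes "AE x in M. f x = g x"
  shows "ereal_integral M f = ereal_integral M g"
proof -
  have "(\<integral>\<^sup>+x. e2ennreal (f x) \<partial>M) = (\<integral>\<^sup>+x. e2ennreal (g x) \<partial>M)"
    and "(\<integral>\<^sup>+x. e2ennreal (- f x) \<partial>M) = (\<integral>\<^sup>+x. e2ennreal (- g x) \<partial>M)"
    using assms by (auto intro!: nn_integral_cong_AE elim!: eventually_mono)
  then show ?thesis by (simp add: ereal_integral_def)
qed

lemma nn_integral_ennreal_less_top:
  fixes h :: "'a \<Rightarrow> real"
  assumes "integrable M h"
  shows "(\<integral>\<^sup>+x. ennreal (h x) \<partial>M) < \<infinity>"
proof -
  have "(\<integral>\<^sup>+x. ennreal (h x) \<partial>M) \<le> (\<integral>\<^sup>+x. ennreal (norm (h x)) \<partial>M)"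
    by (intro nn_integral_mono ennreal_leI) auto
  also have "\<dots> < \<infinity>" using assms by (simp add: integrable_iff_bounded)
  finally show ?thesis .
qed

lemma ereal_integral_ereal:
  assumes "integrable M h"
  shows "ereal_integral M (\<lambda>x. ereal (h x)) = ereal (\<integral>x. h x \<partial>M)"
proof -
  have *: "(\<integral>\<^sup>+x. ennreal (h x) \<partial>M) < \<infinity>" "(\<integral>\<^sup>+x. ennreal (- h x) \<partial>M) < \<infinity>"
    using nn_integral_ennreal_less_top[OF assms] nn_integral_ennreal_less_top[of M "\<lambda>x. - h x"] assms
    by auto
  have "ereal_integral M (\<lambda>x. ereal (h x)) =
      enn2ereal (\<integral>\<^sup>+x. ennreal (h x) \<partial>M) - enn2ereal (\<integral>\<^sup>+x. ennreal (- h x) \<partial>M)"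
    by (simp add: ereal_integral_def e2ennreal_ereal)
  also have "\<dots> = ereal (\<integral>x. h x \<partial>M)"
    using * by (cases "\<integral>\<^sup>+x. ennreal (h x) \<partial>M"; cases "\<integral>\<^sup>+x. ennreal (- h x) \<partial>M")
      (auto simp: real_lebesgue_integral_def[OF assms])
  finally show ?thesis .
qed

text \<open>Negative parts are moved across the inequality until every term is nonnegative, so it
  can be integrated without subtraction. The finite negative parts of \<open>f\<close> and
  \<open>g\<close> then allow moving them back, while the positive parts may have infinite
  integral.\<close>

lemma ereal_integral_le_add:
  assumes [measurable]: "f \<in> borel_measurable M" "g \<in> borel_measurable M"
    and h: "integrable M h"
    and le: "AE x in M. f x \<le> g x + ereal (h x)"
    and f: "(\<integral>\<^sup>+x. e2ennreal (- f x) \<partial>M) < \<infinity>"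
    and g: "(\<integral>\<^sup>+x. e2ennreal (- g x) \<partial>M) < \<infinity>"
  shows "ereal_integral M f \<le> ereal_integral M g + ereal (\<integral>x. h x \<partial>M)"
proof -
  have [measurable]: "h \<in> borel_measurable M" using h by simp
  have *: "(\<integral>\<^sup>+x. ennreal (h x) \<partial>M) < \<infinity>" "(\<integral>\<^sup>+x. ennreal (- h x) \<partial>M) < \<infinity>"
    using nn_integral_ennreal_less_top[OF h] nn_integral_ennreal_less_top[of M "\<lambda>x. - h x"] h
    by auto
  \<comment> \<open>This is \<open>a \<le> b + c\<close> written with positive and negative parts,
    each on the side where it has a plus sign.\<close>
  have pt: "e2ennreal a + e2ennreal (- b) + ennreal (- c) \<le> e2ennreal b + ennreal c + e2ennreal (- a)"
    if "a \<le> b + ereal c" for a b c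
  proof (cases a; cases b)
    fix r s assume "a = ereal r" "b = ereal s"
    then show ?thesis using that
      by (cases "0 \<le> r"; cases "0 \<le> s"; cases "0 \<le> c")
        (simp_all add: e2ennreal_ereal ennreal_neg flip: ennreal_plus)
  qed (use that in auto)
  have "AE x in M. e2ennreal (f x) + e2ennreal (- g x) + ennreal (- h x)
      \<le> e2ennreal (g x) + ennreal (h x) + e2ennreal (- f x)"
    using le by eventually_elim (rule pt)
  then have "(\<integral>\<^sup>+x. e2ennreal (f x) + e2ennreal (- g x) + ennreal (- h x) \<partial>M)
      \<le> (\<integral>\<^sup>+x. e2ennreal (g x) + ennreal (h x) + e2ennreal (- f x) \<partial>M)"
    by (rule nn_integral_mono_AE)
  then have "(\<integral>\<^sup>+x. e2ennreal (f x) \<partial>M) + (\<integral>\<^sup>+x. e2ennreal (- g x) \<partial>M) + (\<integral>\<^sup>+x. ennreal (- h x) \<partial>M)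
      \<le> (\<integral>\<^sup>+x. e2ennreal (g x) \<partial>M) + (\<integral>\<^sup>+x. ennreal (h x) \<partial>M) + (\<integral>\<^sup>+x. e2ennreal (- f x) \<partial>M)"
    by (simp add: nn_integral_add)
  moreover obtain f' where "0 \<le> f'" "(\<integral>\<^sup>+x. e2ennreal (- f x) \<partial>M) = ennreal f'"
    using f by (cases "\<integral>\<^sup>+x. e2ennreal (- f x) \<partial>M") auto
  moreover obtain g' where "0 \<le> g'" "(\<integral>\<^sup>+x. e2ennreal (- g x) \<partial>M) = ennreal g'"
    using g by (cases "\<integral>\<^sup>+x. e2ennreal (- g x) \<partial>M") auto
  moreover obtain h1 where h1: "0 \<le> h1" "(\<integral>\<^sup>+x. ennreal (h x) \<partial>M) = ennreal h1"
    using *(1) by (cases "\<integral>\<^sup>+x. ennreal (h x) \<partial>M") auto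
  moreover obtain h2 where h2: "0 \<le> h2" "(\<integral>\<^sup>+x. ennreal (- h x) \<partial>M) = ennreal h2"
    using *(2) by (cases "\<integral>\<^sup>+x. ennreal (- h x) \<partial>M") auto
  moreover have "(\<integral>x. h x \<partial>M) = h1 - h2"
    using h1 h2 by (simp add: real_lebesgue_integral_def[OF h])
  ultimately show ?thesis
    unfolding ereal_integral_def
    by (cases "\<integral>\<^sup>+x. e2ennreal (f x) \<partial>M"; cases "\<integral>\<^sup>+x. e2ennreal (g x) \<partial>M")
      (simp_all add: top_unique flip: ennreal_plus)
qed

text \<open>Subtracting the integrable \<open>g 0\<close> makes the increasing sequence nonnegative,
  so monotone convergence applies; \<open>ereal_integral_le_add\<close> then restores the integral
  of \<open>g 0\<close>.\<close>

lemma ereal_integral_SUP_le: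
  fixes g :: "nat \<Rightarrow> 'a \<Rightarrow> real"
  assumes g: "\<And>n. integrable M (g n)" and mono: "\<And>x. incseq (\<lambda>n. g n x)"
    and bound: "\<And>n. (\<integral>x. g n x \<partial>M) \<le> B"
  shows "ereal_integral M (\<lambda>x. SUP n. ereal (g n x)) \<le> ereal B"
proof -
  define f where "f = (\<lambda>x. SUP n. ereal (g n x))"
  have [measurable]: "g n \<in> borel_measurable M" for n using g by simp
  have [measurable]: "f \<in> borel_measurable M" by (simp add: f_def)
  have ge: "ereal (g n x) \<le> f x" for n x by (auto simp: f_def intro: SUP_upper)
  have neg0: "e2ennreal (- (f x - ereal (g 0 x))) = 0" for x
    using ge[of 0 x] by (cases "f x") (auto simp: e2ennreal_ereal ennreal_neg e2ennreal_neg)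
  have "(\<integral>\<^sup>+x. e2ennreal (- f x) \<partial>M) \<le> (\<integral>\<^sup>+x. ennreal (- g 0 x) \<partial>M)"
  proof (rule nn_integral_mono)
    fix x show "e2ennreal (- f x) \<le> ennreal (- g 0 x)"
      using ge[of 0 x] by (cases "f x") (auto simp: e2ennreal_ereal e2ennreal_neg intro: ennreal_leI)
  qed
  also have "\<dots> < \<infinity>" using g[of 0] by (intro nn_integral_ennreal_less_top) simp
  finally have negf: "(\<integral>\<^sup>+x. e2ennreal (- f x) \<partial>M) < \<infinity>" .
  have "f x \<le> (f x - ereal (g 0 x)) + ereal (g 0 x)" for x by (cases "f x") auto
  then have 1: "ereal_integral M f \<le>
      ereal_integral M (\<lambda>x. f x - ereal (g 0 x)) + ereal (\<integral>x. g 0 x \<partial>M)"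
    using g negf neg0 by (intro ereal_integral_le_add) auto
  have "(\<integral>\<^sup>+x. e2ennreal (f x - ereal (g 0 x)) \<partial>M) = (\<integral>\<^sup>+x. (SUP n. ennreal (g n x - g 0 x)) \<partial>M)"
  proof (rule nn_integral_cong)
    fix x
    have "f x - ereal (g 0 x) = (SUP n. ereal (g n x) - ereal (g 0 x))"
      unfolding f_def by (intro SUP_ereal_minus_left[symmetric]) auto
    also have "e2ennreal \<dots> = (SUP n. e2ennreal (ereal (g n x) - ereal (g 0 x)))"
      using mono[of x]
      by (intro sup_continuousD[OF sup_continuous_e2ennreal[OF sup_continuous_id]])
        (auto simp: mono_def)
    also have "\<dots> = (SUP n. ennreal (g n x - g 0 x))"
      by (simp add: e2ennreal_ereal)
    finally show "e2ennreal (f x - ereal (g 0 x)) = (SUP n. ennreal (g n x - g 0 x))" .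
  qed
  also have "\<dots> = (SUP n. \<integral>\<^sup>+x. ennreal (g n x - g 0 x) \<partial>M)"
    using mono by (intro nn_integral_monotone_convergence_SUP)
      (auto simp: incseq_def le_fun_def intro!: ennreal_leI)
  also have "\<dots> \<le> ennreal (B - (\<integral>x. g 0 x \<partial>M))"
  proof (rule SUP_least)
    fix n
    have "(\<integral>\<^sup>+x. ennreal (g n x - g 0 x) \<partial>M) = ennreal (\<integral>x. g n x - g 0 x \<partial>M)"
      using g mono by (intro nn_integral_eq_integral) (auto simp: incseq_def)
    then show "(\<integral>\<^sup>+x. ennreal (g n x - g 0 x) \<partial>M) \<le> ennreal (B - (\<integral>x. g 0 x \<partial>M))"
      using g bound[of n] by (auto intro!: ennreal_leI)
  qed
  \<comment> \<open>The bound at index 0 makes the right-hand side nonnegative, so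
    \<open>ennreal\<close> has truncated nothing.\<close>
  finally have "ereal_integral M (\<lambda>x. f x - ereal (g 0 x)) \<le> ereal (B - (\<integral>x. g 0 x \<partial>M))"
    using bound[of 0] by (simp add: ereal_integral_def neg0 less_eq_ennreal.rep_eq zero_ennreal.rep_eq)
  then have "ereal_integral M f \<le> ereal (B - (\<integral>x. g 0 x \<partial>M)) + ereal (\<integral>x. g 0 x \<partial>M)"
    by (rule order_trans[OF 1 add_right_mono])
  then show ?thesis by (simp add: f_def)
qed

section \<open>Utility functions and their convex duals\<close>

lemma utility_less: "utility_function u \<Longrightarrow> 0 < x \<Longrightarrow> x < y \<Longrightarrow> u x < u y"
  by (auto simp: utility_function_def strict_mono_on_def)

lemma utility_mono: "utility_function u \<Longrightarrow> 0 < x \<Longrightarrow> x \<le> y \<Longrightarrow> u x \<le> u y"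
  using utility_less[of u x y] by (cases "x = y") auto

lemma utility_concave:
  assumes "utility_function u" "0 < x" "0 < y" "0 < t" "t < 1"
  shows "(1 - t) * u x + t * u y \<le> u ((1 - t) * x + t * y)"
proof (cases "x = y")
  case True
  then show ?thesis by (simp add: algebra_simps)
next
  case False
  then show ?thesis
    using assms by (force simp: utility_function_def strictly_concave_on_def intro: less_imp_le)
qed

lemma utility_continuous_on: "utility_function u \<Longrightarrow> continuous_on {0<..} u"
  unfolding utility_function_def
  by (meson continuous_at_imp_continuous_on differentiable_imp_continuous_within greaterThan_iff)

text \<open>The values of \<open>u\<close> outside the positive half-line are arbitrary, so
  measurability comes from continuity on the restricted space.\<close>

lemma borel_measurable_utility:
  assumes u: "utility_function u" and w: "w \<in> borel_measurable M" and pos: "\<And>x. 0 < w x"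
  shows "(\<lambda>x. u (w x)) \<in> borel_measurable M"
proof -
  have "u \<in> borel_measurable (restrict_space borel {0<..})"
    by (rule borel_measurable_continuous_on_restrict[OF utility_continuous_on[OF u]])
  moreover have "w \<in> M \<rightarrow>\<^sub>M restrict_space borel {0<..}"
    using w pos by (intro measurable_restrict_space2) auto
  ultimately show ?thesis by (rule measurable_compose[rotated])
qed

text \<open>Since the derivative of \<open>u\<close> tends to 0, it is below \<open>y\<close> from
  some point \<open>X\<close> on, where \<open>u x - y * x\<close> is therefore nonincreasing.
  Before \<open>X\<close>, monotonicity of \<open>u\<close> gives the bound
  \<open>u X\<close>.\<close>

lemma bdd_above_dual:
  assumes u: "utility_function u" and y: "0 < y"
  shows "bdd_above ((\<lambda>x. u x - y * x) ` {0<..})"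
proof -
  have "\<forall>\<^sub>F x in at_top. deriv u x < y"
    using u y unfolding utility_function_def by (auto intro: order_tendstoD)
  then obtain X0 where X0: "\<And>x. X0 \<le> x \<Longrightarrow> deriv u x < y"
    by (auto simp: eventually_at_top_linorder)
  define X where "X = max 1 X0"
  have "u x - y * x \<le> u X" if x: "0 < x" for x
  proof (cases "x \<le> X")
    case True
    then show ?thesis using utility_mono[OF u x True] mult_pos_pos[OF y x] by simp
  next
    case False
    have "u x - y * x \<le> u X - y * X"
    proof (rule DERIV_nonpos_imp_nonincreasing[where f = "\<lambda>x. u x - y * x"])
      show "X \<le> x" using False by simp
      fix z assume z: "X \<le> z" "z \<le> x"
      have "u differentiable at z" using u z by (auto simp: utility_function_def X_def)
      then have "(u has_real_derivative deriv u z) (at z)"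
        by (simp add: DERIV_deriv_iff_real_differentiable)
      then have "((\<lambda>x. u x - y * x) has_real_derivative deriv u z - y) (at z)"
        by (auto intro!: derivative_eq_intros)
      moreover have "deriv u z - y \<le> 0" using X0[of z] z by (simp add: X_def)
      ultimately show "\<exists>d. ((\<lambda>x. u x - y * x) has_real_derivative d) (at z) \<and> d \<le> 0" by blast
    qed
    moreover have "0 < y * X" using y by (simp add: X_def)
    ultimately show ?thesis by linarith
  qed
  then show ?thesis by (auto simp: bdd_above_def)
qed

section \<open>Boundary limits of monotone functions and the extended functions\<close>

lemma tendsto_INF_at_right:
  fixes f :: "real \<Rightarrow> ereal"
  assumes "\<And>x y. 0 < x \<Longrightarrow> x \<le> y \<Longrightarrow> f x \<le> f y"
  shows "(f \<longlongrightarrow> (INF x\<in>{0<..}. f x)) (at_right 0)"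
proof (rule order_tendstoI)
  fix a assume "a < (INF x\<in>{0<..}. f x)"
  then show "\<forall>\<^sub>F x in at_right 0. a < f x"
    by (auto simp: eventually_at_right_field less_INF_D intro!: exI[of _ 1])
next
  fix a assume "(INF x\<in>{0<..}. f x) < a"
  then obtain b where "0 < b" "f b < a" by (auto simp: INF_less_iff)
  then show "\<forall>\<^sub>F x in at_right 0. f x < a"
    using assms by (auto simp: eventually_at_right_field intro!: exI[of _ b] le_less_trans[OF _ \<open>f b < a\<close>])
qed

lemma tendsto_SUP_at_right:
  fixes f :: "real \<Rightarrow> ereal"
  assumes "\<And>x y. 0 < x \<Longrightarrow> x \<le> y \<Longrightarrow> f y \<le> f x"
  shows "(f \<longlongrightarrow> (SUP x\<in>{0<..}. f x)) (at_right 0)"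
proof -
  have "((\<lambda>x. - f x) \<longlongrightarrow> (INF x\<in>{0<..}. - f x)) (at_right 0)"
    using assms by (intro tendsto_INF_at_right) auto
  then show ?thesis
    by (simp add: ereal_INF_uminus_eq flip: ereal_Lim_uminus)
qed

lemma tendsto_SUP_at_top:
  fixes f :: "real \<Rightarrow> ereal"
  assumes "\<And>x y. 0 < x \<Longrightarrow> x \<le> y \<Longrightarrow> f x \<le> f y"
  shows "(f \<longlongrightarrow> (SUP x\<in>{0<..}. f x)) at_top"
proof (rule order_tendstoI)
  fix a assume "(SUP x\<in>{0<..}. f x) < a"
  then show "\<forall>\<^sub>F x in at_top. f x < a"
    by (intro eventually_mono[OF eventually_gt_at_top[of 0]]) (auto dest: SUP_lessD)
next
  fix a assume "a < (SUP x\<in>{0<..}. f x)"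
  then obtain b where "0 < b" "a < f b" by (auto simp: less_SUP_iff)
  then show "\<forall>\<^sub>F x in at_top. a < f x"
    using assms by (intro eventually_mono[OF eventually_ge_at_top[of b]]) (auto intro: less_le_trans)
qed

lemma extend_by_limits_ereal: "0 < x \<Longrightarrow> extend_by_limits f (ereal x) = ereal (f x)"
  by (simp add: extend_by_limits_def)

lemma extend_utility_0:
  assumes "utility_function u"
  shows "extend_by_limits u 0 = (INF x\<in>{0<..}. ereal (u x))"
  unfolding extend_by_limits_def using utility_mono[OF assms]
  by (auto intro!: tendsto_Lim tendsto_INF_at_right)

lemma extend_utility_infinity:
  assumes "utility_function u"
  shows "extend_by_limits u \<infinity> = (SUP x\<in>{0<..}. ereal (u x))"
  unfolding extend_by_limits_def using utility_mono[OF assms]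
  by (auto intro!: tendsto_Lim tendsto_SUP_at_top)

text \<open>For \<open>y > 0\<close> the supremum is finite, so the real and the extended one agree.
  At \<open>y = 0\<close> the limit of the nonincreasing dual is a supremum over \<open>y\<close>,
  and the two suprema commute.\<close>

lemma extend_dual:
  assumes u: "utility_function u" and y: "0 \<le> y"
  shows "extend_by_limits (convex_dual u) (ereal y) = (SUP x\<in>{0<..}. ereal (u x - y * x))"
proof -
  have pos: "ereal (convex_dual u y) = (SUP x\<in>{0<..}. ereal (u x - y * x))" if "0 < y" for y
  proof -
    obtain B where "\<And>x. 0 < x \<Longrightarrow> u x - y * x \<le> B"
      using bdd_above_dual[OF u \<open>0 < y\<close>] by (auto simp: bdd_above_def)
    then have "(SUP x\<in>{0<..}. ereal (u x - y * x)) \<le> ereal B"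
      by (auto intro!: SUP_least)
    moreover have "ereal (u 1 - y * 1) \<le> (SUP x\<in>{0<..}. ereal (u x - y * x))"
      by (rule SUP_upper) simp
    ultimately have "\<bar>SUP x\<in>{0<..}. ereal (u x - y * x)\<bar> \<noteq> \<infinity>" by auto
    then show ?thesis unfolding convex_dual_def by (rule ereal_SUP)
  qed
  show ?thesis
  proof (cases "y = 0")
    case False
    then show ?thesis using pos y by (simp add: extend_by_limits_ereal)
  next
    case True
    have "ereal (convex_dual u y) \<le> ereal (convex_dual u z)" if "0 < z" "z \<le> y" for y z
      using that pos[of y] pos[of z] by (auto intro!: SUP_subset_mono mult_right_mono)
    then have "extend_by_limits (convex_dual u) 0 = (SUP y\<in>{0<..}. ereal (convex_dual u y))"
      unfolding extend_by_limits_def by (auto intro!: tendsto_Lim tendsto_SUP_at_right)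
    also have "\<dots> = (SUP y\<in>{0<..}. SUP x\<in>{0<..}. ereal (u x - y * x))"
      by (simp add: pos)
    also have "\<dots> = (SUP x\<in>{0<..}. SUP y\<in>{0<..}. ereal (u x - y * x))"
      by (rule SUP_commute)
    also have "\<dots> = (SUP x\<in>{0<..}. ereal (u x))"
    proof (rule SUP_cong[OF refl], rule antisym)
      fix x :: real assume x: "x \<in> {0<..}"
      then show "(SUP y\<in>{0<..}. ereal (u x - y * x)) \<le> ereal (u x)"
        by (auto intro!: SUP_least)
      show "ereal (u x) \<le> (SUP y\<in>{0<..}. ereal (u x - y * x))"
      proof (rule ereal_le_epsilon2)
        fix e :: real assume "0 < e"
        \<comment> \<open>The choice \<open>y = e / x\<close> makes the linear term exactly
          \<open>e\<close>.\<close>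
        then have "ereal (u x - e / x * x) \<le> (SUP y\<in>{0<..}. ereal (u x - y * x))"
          using x by (intro SUP_upper) auto
        then have "ereal (u x - e / x * x) + ereal e \<le> (SUP y\<in>{0<..}. ereal (u x - y * x)) + ereal e"
          by (rule add_right_mono)
        then show "ereal (u x) \<le> (SUP y\<in>{0<..}. ereal (u x - y * x)) + ereal e"
          using x by simp
      qed
    qed
    finally show ?thesis using True by (simp flip: zero_ereal_def)
  qed
qed

lemma fenchel_inequality:
  assumes u: "utility_function u" and "0 \<le> y" "0 \<le> w"
  shows "extend_by_limits u (ereal w) \<le> extend_by_limits (convex_dual u) (ereal y) + ereal (y * w)"
proof -
  have V: "ereal (u x) \<le> extend_by_limits (convex_dual u) (ereal y) + ereal (y * x)" if "0 < x" for x
  proof -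
    have "ereal (u x) = ereal (u x - y * x) + ereal (y * x)" by simp
    also have "\<dots> \<le> extend_by_limits (convex_dual u) (ereal y) + ereal (y * x)"
      unfolding extend_dual[OF u \<open>0 \<le> y\<close>] using that by (intro add_right_mono SUP_upper) auto
    finally show ?thesis .
  qed
  show ?thesis
  proof (cases "w = 0")
    case False
    then show ?thesis using V[of w] assms by (simp add: extend_by_limits_ereal)
  next
    case True
    have "extend_by_limits u 0 \<le> extend_by_limits (convex_dual u) (ereal y)"
    proof (rule ereal_le_epsilon2)
      fix e :: real assume e: "0 < e"
      \<comment> \<open>The value at 0 is below every \<open>u x\<close>, so a small
        \<open>x\<close> whose cost \<open>y * x\<close> is at most \<open>e\<close> suffices.
        Adding 1 to the denominator covers \<open>y = 0\<close>.\<close>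
      define x where "x = e / (y + 1)"
      have x: "0 < x" "y * x \<le> e" using e \<open>0 \<le> y\<close> by (auto simp: x_def field_simps)
      have "extend_by_limits u 0 \<le> ereal (u x)"
        using x by (auto simp: extend_utility_0[OF u] intro: INF_lower)
      also note V[OF x(1)]
      also have "extend_by_limits (convex_dual u) (ereal y) + ereal (y * x)
          \<le> extend_by_limits (convex_dual u) (ereal y) + ereal e"
        using x by (intro add_left_mono) auto
      finally show "extend_by_limits u 0 \<le> extend_by_limits (convex_dual u) (ereal y) + ereal e" .
    qed
    then show ?thesis using True by (simp flip: zero_ereal_def)
  qed
qed


section \<open>The extended utility and its inverse\<close>

lemma extend_utility_less:
  assumes u: "utility_function u" and "0 \<le> a" "a < b"
  shows "extend_by_limits u a < extend_by_limits u b"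
proof -
  \<comment> \<open>Comparison with the limits at the endpoints gives only weak inequalities;
    strictness comes from two intermediate reals \<open>c < d\<close>.\<close>
  obtain c where c: "a < ereal c" "ereal c < b" using ereal_dense2[OF \<open>a < b\<close>] by blast
  obtain d where d: "ereal c < ereal d" "ereal d < b" using ereal_dense2[OF c(2)] by blast
  have "0 < ereal c" using \<open>0 \<le> a\<close> c(1) by (rule le_less_trans)
  then have "0 < c" by simp
  have "extend_by_limits u a \<le> ereal (u c)"
  proof (cases "a = 0")
    case True
    then show ?thesis using \<open>0 < c\<close> by (auto simp: extend_utility_0[OF u] intro: INF_lower)
  next
    case False
    then show ?thesis using \<open>0 \<le> a\<close> c(1)
      by (cases a) (auto simp: extend_by_limits_ereal intro!: utility_mono[OF u])
  qed
  also have "\<dots> < ereal (u d)" using \<open>0 < c\<close> d(1) utility_less[OF u] by simp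
  also have "\<dots> \<le> extend_by_limits u b"
  proof (cases b)
    case PInf
    then show ?thesis using \<open>0 < c\<close> d(1)
      by (auto simp: extend_utility_infinity[OF u] intro!: SUP_upper)
  qed (use \<open>0 < c\<close> d in \<open>auto simp: extend_by_limits_ereal intro!: utility_mono[OF u]\<close>)
  finally show ?thesis .
qed

text \<open>The inverse is meaningful only on the range of the extended \<open>u\<close>. The bounds
  put \<open>v\<close> there: it is either the value at infinity or attained at a real point by the
  intermediate value theorem.\<close>

lemma utility_inverse_nonneg:
  assumes u: "utility_function u" and v: "ereal (u 1) \<le> v" "v \<le> extend_by_limits u \<infinity>"
  shows "0 \<le> utility_inverse u v"
proof -
  have inj: "inj_on (extend_by_limits u) {0..}"
    by (rule inj_onI) (metis atLeast_iff extend_utility_less[OF u] less_irrefl neqE)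
  have "\<exists>x\<ge>0. extend_by_limits u x = v"
  proof (cases "v = extend_by_limits u \<infinity>")
    case True
    then show ?thesis by (intro exI[of _ \<infinity>]) auto
  next
    case False
    with v have "v < (SUP x\<in>{0<..}. ereal (u x))"
      unfolding extend_utility_infinity[OF u] by simp
    then obtain b where b: "0 < b" "v < ereal (u b)" by (auto simp: less_SUP_iff)
    with v obtain r where r: "v = ereal r" "u 1 \<le> r" "r < u b" by (cases v) auto
    have "1 \<le> b" using utility_mono[OF u b(1), of 1] r by linarith
    moreover have "continuous_on {1..b} u"
      by (rule continuous_on_subset[OF utility_continuous_on[OF u]]) auto
    ultimately obtain x where "1 \<le> x" "u x = r" using IVT'[of u 1 r b] r by auto
    then show ?thesis using r(1) by (intro exI[of _ "ereal x"]) (auto simp: extend_by_limits_ereal)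
  qed
  then obtain x where "0 \<le> x" "extend_by_limits u x = v" by blast
  then show ?thesis unfolding utility_inverse_def using the_inv_into_f_f[OF inj, of x] by simp
qed

lemma exp_ln_ereal: "0 \<le> x \<Longrightarrow> exp_ereal (ln_ereal x) = x"
  by (cases x) (auto simp: exp_ereal_def ln_ereal_def zero_ereal_def)

section \<open>Approximate maximisers of the dual problem\<close>

text \<open>A running maximiser of \<open>u x - y * x\<close> over the candidates
  \<open>q 0, ..., q n\<close>. The recursion makes the selection measurable in \<open>y\<close> and
  the attained value increasing in \<open>n\<close>.\<close>

primrec dual_argmax :: "(real \<Rightarrow> real) \<Rightarrow> (nat \<Rightarrow> real) \<Rightarrow> nat \<Rightarrow> real \<Rightarrow> real" where
  "dual_argmax u q 0 y = q 0"
| "dual_argmax u q (Suc n) y =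
     (if u (dual_argmax u q n y) - y * dual_argmax u q n y < u (q (Suc n)) - y * q (Suc n)
      then q (Suc n) else dual_argmax u q n y)"

lemma dual_argmax_in: "dual_argmax u q n y \<in> q ` {..n}"
  by (induction n) (auto intro: le_SucI)

lemma dual_argmax_mono:
  "incseq (\<lambda>n. u (dual_argmax u q n y) - y * dual_argmax u q n y)"
  by (rule incseq_SucI) auto

lemma dual_argmax_ge: "u (q n) - y * q n \<le> u (dual_argmax u q n y) - y * dual_argmax u q n y"
  by (cases n) auto

lemma dual_argmax_pos: "(\<And>n. 0 < q n) \<Longrightarrow> 0 < dual_argmax u q n y"
  using dual_argmax_in[of u q n y] by auto

lemma borel_measurable_dual_argmax:
  assumes u: "utility_function u" and q: "\<And>n. 0 < q n"
  shows "dual_argmax u q n \<in> borel_measurable borel"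
proof (induction n)
  case (Suc n)
  note [measurable] = Suc borel_measurable_utility[OF u Suc dual_argmax_pos[of q, OF q]]
  show ?case by simp
qed simp

lemma dense_positive_sequence:
  obtains q :: "nat \<Rightarrow> real"
  where "\<And>n. 0 < q n" "\<And>x z. 0 < x \<Longrightarrow> x < z \<Longrightarrow> \<exists>n. x < q n \<and> q n < z"
proof -
  let ?A = "{0<..} \<inter> \<rat> :: real set"
  have "1 \<in> ?A" by simp
  then have "?A \<noteq> {}" by blast
  moreover have "countable ?A" using countable_rat by (rule countable_Int2)
  ultimately have range: "range (from_nat_into ?A) = ?A" by (rule range_from_nat_into)
  show ?thesis
  proof
    show "0 < from_nat_into ?A n" for n using range by auto
    show "\<exists>n. x < from_nat_into ?A n \<and> from_nat_into ?A n < z" if "0 < x" "x < z" for x z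
    proof -
      obtain r where "r \<in> \<rat>" "x < r" "r < z" using Rats_dense_in_real[OF \<open>x < z\<close>] by blast
      then have "r \<in> range (from_nat_into ?A)" using range \<open>0 < x\<close> by auto
      then show ?thesis using \<open>x < r\<close> \<open>r < z\<close> by auto
    qed
  qed
qed

text \<open>Each \<open>x\<close> is approximated by some \<open>q n\<close> from the right: there
  \<open>u\<close> is no smaller, and only the linear cost grows, by at most
  \<open>e\<close>.\<close>

lemma SUP_dual_argmax:
  assumes u: "utility_function u" and q: "\<And>n. 0 < q n"
    and dense: "\<And>x z. 0 < x \<Longrightarrow> x < z \<Longrightarrow> \<exists>n. x < q n \<and> q n < z" and y: "0 \<le> y"
  shows "(SUP n. ereal (u (dual_argmax u q n y) - y * dual_argmax u q n y)) =
    extend_by_limits (convex_dual u) (ereal y)" (is "?S = _")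
  unfolding extend_dual[OF u y]
proof (rule antisym)
  show "?S \<le> (SUP x\<in>{0<..}. ereal (u x - y * x))"
    using dual_argmax_pos[of q, OF q] by (intro SUP_least SUP_upper) simp
  show "(SUP x\<in>{0<..}. ereal (u x - y * x)) \<le> ?S"
  proof (rule SUP_least, rule ereal_le_epsilon2)
    fix x e :: real assume x: "x \<in> {0<..}" and e: "0 < e"
    have "x < x + e / (y + 1)" using e y by simp
    then obtain n where n: "x < q n" "q n < x + e / (y + 1)"
      using dense[of x "x + e / (y + 1)"] x unfolding greaterThan_iff by blast
    have "y * q n \<le> y * (x + e / (y + 1))" using n y by (intro mult_left_mono) auto
    also have "\<dots> \<le> y * x + e" using y e by (simp add: field_simps)
    finally have "u x - y * x \<le> u (q n) - y * q n + e" using utility_mono[OF u, of x "q n"] x n by simp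
    then have "ereal (u x - y * x) \<le> ereal (u (dual_argmax u q n y) - y * dual_argmax u q n y) + ereal e"
      using dual_argmax_ge[of u q n y] by simp
    also have "\<dots> \<le> ?S + ereal e" by (intro add_right_mono SUP_upper) simp
    finally show "ereal (u x - y * x) \<le> ?S + ereal e" .
  qed
qed

section \<open>Duality\<close>

locale utility_pair = \<mu>: prob_space \<mu> + \<nu>: prob_space \<nu>
  for \<mu> \<nu> :: "'a measure" +
  fixes u :: "real \<Rightarrow> real"
  assumes utility: "utility_function u"
    and sets_eq: "sets \<mu> = sets \<nu>"
    and ac: "absolutely_continuous \<nu> \<mu>"
begin

text \<open>A real-valued version of the density of \<mu> with respect to \<nu>, for use in Bochner
  integrals.\<close>

definition Z :: "'a \<Rightarrow> real" where
  "Z x = enn2real (RN_deriv \<nu> \<mu> x)"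

text \<open>Bounds away from both 0 and infinity make \<open>u (w x)\<close> bounded, so that price
  and gain are finite integrals, and they survive convex combination.\<close>

definition bounded_plans :: "('a \<Rightarrow> real) set" where
  "bounded_plans = {w \<in> borel_measurable \<nu>. \<exists>a b. 0 < a \<and> (\<forall>x. a \<le> w x \<and> w x \<le> b)}"

text \<open>For measurable \<open>w\<close> this is the integral of \<open>w\<close> under \<mu>, by
  \<open>integral_Z\<close>; the budget constraint on densities is price 1.\<close>

definition price :: "('a \<Rightarrow> real) \<Rightarrow> real" where
  "price w = (\<integral>x. Z x * w x \<partial>\<nu>)"

definition gain :: "('a \<Rightarrow> real) \<Rightarrow> real" where
  "gain w = (\<integral>x. u (w x) \<partial>\<nu>)"

lemma Z_nonneg: "0 \<le> Z x"
  by (simp add: Z_def)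

lemma measurable_Z [measurable]: "Z \<in> borel_measurable \<nu>"
  by (simp add: Z_def[abs_def])

text \<open>Because \<mu> is sigma-finite, its density is infinite at most on a \<nu>-null
  set.\<close>

lemma AE_RN_deriv: "AE x in \<nu>. enn2ereal (RN_deriv \<nu> \<mu> x) = ereal (Z x)"
  using \<nu>.RN_deriv_finite[OF \<mu>.sigma_finite_measure_axioms ac sets_eq]
proof eventually_elim
  case (elim x)
  then show ?case by (cases "RN_deriv \<nu> \<mu> x") (auto simp: Z_def)
qed

lemma
  assumes "f \<in> borel_measurable \<nu>"
  shows integrable_Z_iff: "integrable \<mu> f \<longleftrightarrow> integrable \<nu> (\<lambda>x. Z x * f x)"
    and integral_Z: "(\<integral>x. f x \<partial>\<mu>) = (\<integral>x. Z x * f x \<partial>\<nu>)"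
  unfolding Z_def
  using \<nu>.RN_deriv_integrable[OF \<mu>.sigma_finite_measure_axioms ac sets_eq assms]
    \<nu>.RN_deriv_integral[OF \<mu>.sigma_finite_measure_axioms ac sets_eq assms] by auto

lemma price_const: "price (\<lambda>_. c) = c"
  using integral_Z[of "\<lambda>_. c"] by (simp add: price_def \<mu>.prob_space)

lemma gain_const: "gain (\<lambda>_. c) = u c"
  by (simp add: gain_def \<nu>.prob_space)

section \<open>Price and gain of bounded plans\<close>

lemma bounded_plans_measurable: "w \<in> bounded_plans \<Longrightarrow> w \<in> borel_measurable \<nu>"
  by (simp add: bounded_plans_def)

lemma bounded_plans_pos: "w \<in> bounded_plans \<Longrightarrow> 0 < w x"
  by (auto simp: bounded_plans_def intro: less_le_trans)

lemma bounded_plans_const: "0 < c \<Longrightarrow> (\<lambda>_. c) \<in> bounded_plans"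
  by (auto simp: bounded_plans_def)

text \<open>The weights are not tied to sum to 1, so the same lemma serves for convex combinations
  and for adding a constant to a plan.\<close>

lemma bounded_plans_mix:
  assumes "w \<in> bounded_plans" "w' \<in> bounded_plans" "0 < s" "0 < t"
  shows "(\<lambda>x. s * w x + t * w' x) \<in> bounded_plans"
proof -
  obtain a b where ab: "0 < a" "\<And>x. a \<le> w x \<and> w x \<le> b" and w: "w \<in> borel_measurable \<nu>"
    using assms(1) by (auto simp: bounded_plans_def)
  obtain a' b' where ab': "0 < a'" "\<And>x. a' \<le> w' x \<and> w' x \<le> b'" and w': "w' \<in> borel_measurable \<nu>"
    using assms(2) by (auto simp: bounded_plans_def)
  have "0 < s * a + t * a'" using assms ab ab' by (simp add: add_pos_pos)
  moreover have "s * a + t * a' \<le> s * w x + t * w' x" "s * w x + t * w' x \<le> s * b + t * b'" for x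
    using assms ab ab' by (auto intro!: add_mono mult_left_mono)
  moreover have "(\<lambda>x. s * w x + t * w' x) \<in> borel_measurable \<nu>" using w w' by simp
  ultimately show ?thesis unfolding bounded_plans_def by blast
qed

lemma integrable_gain:
  assumes "w \<in> bounded_plans"
  shows "integrable \<nu> (\<lambda>x. u (w x))"
proof -
  obtain a b where "0 < a" "\<And>x. a \<le> w x \<and> w x \<le> b"
    using assms by (auto simp: bounded_plans_def)
  then have "u a \<le> u (w x)" "u (w x) \<le> u b" for x
    using utility_mono[OF utility] bounded_plans_pos[OF assms] by auto
  then have "norm (u (w x)) \<le> max \<bar>u a\<bar> \<bar>u b\<bar>" for x
    by (smt (verit) real_norm_def)
  then show ?thesis
    using borel_measurable_utility[OF utility bounded_plans_measurable[OF assms]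
        bounded_plans_pos[OF assms]]
    by (intro \<nu>.integrable_const_bound[of _ "max \<bar>u a\<bar> \<bar>u b\<bar>"]) auto
qed

lemma integrable_price:
  assumes "w \<in> bounded_plans"
  shows "integrable \<nu> (\<lambda>x. Z x * w x)"
proof -
  obtain b where "\<And>x. w x \<le> b" using assms by (auto simp: bounded_plans_def)
  then have "norm (w x) \<le> b" for x
    using bounded_plans_pos[OF assms, of x] by simp
  then have "integrable \<mu> w"
    using bounded_plans_measurable[OF assms] measurable_cong_sets[OF sets_eq refl, of borel]
    by (intro \<mu>.integrable_const_bound[of _ b]) auto
  then show ?thesis using integrable_Z_iff[OF bounded_plans_measurable[OF assms]] by simp
qed

lemma price_mix:
  assumes "w \<in> bounded_plans" "w' \<in> bounded_plans"
  shows "price (\<lambda>x. s * w x + t * w' x) = s * price w + t * price w'"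
proof -
  have "price (\<lambda>x. s * w x + t * w' x) = (\<integral>x. s * (Z x * w x) + t * (Z x * w' x) \<partial>\<nu>)"
    unfolding price_def by (intro Bochner_Integration.integral_cong) (auto simp: algebra_simps)
  then show ?thesis using integrable_price[OF assms(1)] integrable_price[OF assms(2)]
    by (simp add: price_def)
qed

lemma gain_mix:
  assumes "w \<in> bounded_plans" "w' \<in> bounded_plans" "0 < t" "t < 1"
  shows "(1 - t) * gain w + t * gain w' \<le> gain (\<lambda>x. (1 - t) * w x + t * w' x)"
proof -
  note int = integrable_gain[OF assms(1)] integrable_gain[OF assms(2)]
  have "(1 - t) * gain w + t * gain w' = (\<integral>x. (1 - t) * u (w x) + t * u (w' x) \<partial>\<nu>)"
    using int by (simp add: gain_def)
  also have "\<dots> \<le> gain (\<lambda>x. (1 - t) * w x + t * w' x)"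
    unfolding gain_def using assms int
    by (intro integral_mono integrable_gain bounded_plans_mix utility_concave[OF utility])
      (auto intro: bounded_plans_pos)
  finally show ?thesis .
qed

lemma ereal_gain:
  assumes "w \<in> bounded_plans"
  shows "ereal_integral \<nu> (\<lambda>x. extend_by_limits u (ereal (w x))) = ereal (gain w)"
  using ereal_integral_ereal[OF integrable_gain[OF assms]] bounded_plans_pos[OF assms]
  by (simp add: gain_def extend_by_limits_ereal)

section \<open>Bounded plans as competitors and the Lagrange multiplier\<close>

lemma bounded_plans_admissible:
  assumes w: "w \<in> bounded_plans" and "price w = 1"
  shows "w \<in> admissible u \<nu> \<mu>"
proof -
  note m = bounded_plans_measurable[OF w]
  have "integrable \<mu> w" using integrable_Z_iff[OF m] integrable_price[OF w] by simp
  moreover have "(\<integral>x. w x \<partial>\<mu>) = 1" using integral_Z[OF m] assms by (simp add: price_def)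
  ultimately have "w \<in> densities \<mu>"
    using bounded_plans_pos[OF w] by (auto simp: densities_def intro: less_imp_le)
  moreover have "ereal_integrable \<nu> (\<lambda>x. max (- extend_by_limits u (ereal (w x))) 0)"
  proof -
    have eq: "max (- extend_by_limits u (ereal (w x))) 0 = ereal (max (- u (w x)) 0)" for x
      using bounded_plans_pos[OF w, of x] by (simp add: extend_by_limits_ereal max_def)
    have int: "integrable \<nu> (\<lambda>x. max (- u (w x)) 0)" using integrable_gain[OF w] by simp
    have "(\<lambda>x. ereal (max (- u (w x)) 0)) \<in> borel_measurable \<nu>" using int by measurable
    moreover have "e2ennreal \<bar>ereal (max (- u (w x)) 0)\<bar> = ennreal (max (- u (w x)) 0)" for x
      by (simp only: abs_ereal.simps e2ennreal_ereal) simp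
    ultimately show ?thesis
      unfolding ereal_integrable_def eq using nn_integral_ennreal_less_top[OF int] by simp
  qed
  ultimately show ?thesis by (simp add: admissible_def)
qed

lemma gain_le_N:
  assumes "w \<in> bounded_plans" "price w = 1"
  shows "ereal (gain w) \<le> N_util u \<nu> \<mu>"
  unfolding N_util_def ereal_gain[OF assms(1), symmetric]
  by (intro SUP_upper bounded_plans_admissible assms)

lemma N_ge: "ereal (u 1) \<le> N_util u \<nu> \<mu>"
  using gain_le_N[OF bounded_plans_const, of 1] by (simp add: price_const gain_const)

text \<open>The attainable pairs of price and gain form a convex set which does not meet the ray above
  \<open>(1, N)\<close>. The slope of a separating line is the Lagrange multiplier of the budget constraint.\<close>

lemma supporting_slope:
  assumes N: "N_util u \<nu> \<mu> = ereal N"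
  obtains L where "0 \<le> L" "\<And>w. w \<in> bounded_plans \<Longrightarrow> gain w - N \<le> L * (price w - 1)"
proof -
  have le_N: "gain w \<le> N" if "w \<in> bounded_plans" "price w = 1" for w
    using gain_le_N[OF that] by (simp add: N)
  \<comment> \<open>These are the slopes from the point \<open>(1, N)\<close> to attainable points
    on its right; their supremum will be \<open>L\<close>. Inserting 0 makes it nonnegative.\<close>
  define S where "S = insert 0 {(gain w - N) / (price w - 1) | w. w \<in> bounded_plans \<and> 1 < price w}"
  \<comment> \<open>Every slope to the right is at most every slope to the left, so the supremum
    separates the two families.\<close>
  have S_le: "s \<le> (N - gain w) / (1 - price w)"
    if w: "w \<in> bounded_plans" "price w < 1" and s: "s \<in> S" for s w
  proof -
    consider "s = 0" | w' where "w' \<in> bounded_plans" "1 < price w'" "s = (gain w' - N) / (price w' - 1)"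
      using s by (auto simp: S_def)
    then show ?thesis
    proof cases
      case 1
      \<comment> \<open>The unspent budget is added as a constant: the price becomes 1 and the gain
        does not drop.\<close>
      have const: "(\<lambda>_. 1 - price w) \<in> bounded_plans" using w by (intro bounded_plans_const) simp
      have mix: "(\<lambda>x. 1 * w x + 1 * (1 - price w)) \<in> bounded_plans"
        by (rule bounded_plans_mix[OF w(1) const]) auto
      have "gain w \<le> gain (\<lambda>x. 1 * w x + 1 * (1 - price w))"
        unfolding gain_def using w bounded_plans_pos[OF w(1)]
        by (intro integral_mono integrable_gain mix utility_mono[OF utility]) auto
      also have "\<dots> \<le> N"
        using price_mix[OF w(1) const, of 1 1] by (intro le_N mix) (simp add: price_const)
      finally show ?thesis using 1 w by simp
    next
      case (2 w')
      \<comment> \<open>This is the weight at which the mixture of the cheap plan \<open>w\<close>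
        and the expensive plan \<open>w'\<close> has price exactly 1.\<close>
      define t where "t = (1 - price w) / (price w' - price w)"
      have t: "0 < t" "t < 1" using w 2 by (auto simp: t_def field_simps)
      have "price (\<lambda>x. (1 - t) * w x + t * w' x) = price w + t * (price w' - price w)"
        unfolding price_mix[OF w(1) 2(1)] by (simp add: algebra_simps)
      also have "\<dots> = 1" using w 2 by (simp add: t_def)
      finally have "(1 - t) * gain w + t * gain w' \<le> N"
        using gain_mix[OF w(1) 2(1) t] le_N[OF bounded_plans_mix[OF w(1) 2(1)]] t
        by (meson diff_gt_0_iff_gt order_trans)
      then have "((1 - t) * gain w + t * gain w') * (price w' - price w) \<le> N * (price w' - price w)"
        using w 2 by (intro mult_right_mono) auto
      moreover have "t * (price w' - price w) = 1 - price w" using w 2 by (simp add: t_def)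
      then have "((1 - t) * gain w + t * gain w') * (price w' - price w) =
          (price w' - 1) * gain w + (1 - price w) * gain w'"
        by algebra
      ultimately have "(gain w' - N) * (1 - price w) \<le> (N - gain w) * (price w' - 1)"
        by (simp add: algebra_simps)
      then show ?thesis using w 2 by (simp add: frac_le_eq divide_le_eq le_divide_eq mult.commute)
    qed
  qed
  \<comment> \<open>One plan to the left of budget 1 is enough to bound \<open>S\<close>
    above.\<close>
  have half: "(\<lambda>_. 1 / 2) \<in> bounded_plans" "price (\<lambda>_. 1 / 2) < 1"
    by (auto intro: bounded_plans_const simp: price_const)
  have bdd: "bdd_above S" using S_le[OF half] by (auto simp: bdd_above_def)
  have "0 \<in> S" by (simp add: S_def)
  show thesis
  proof
    show "0 \<le> Sup S" by (rule cSup_upper[OF \<open>0 \<in> S\<close> bdd])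
    fix w assume w: "w \<in> bounded_plans"
    consider "price w < 1" | "price w = 1" | "1 < price w" by linarith
    then show "gain w - N \<le> Sup S * (price w - 1)"
    proof cases
      case 1
      then have "Sup S \<le> (N - gain w) / (1 - price w)"
        using S_le[OF w 1] \<open>0 \<in> S\<close> by (intro cSup_least) auto
      then show ?thesis using 1 by (simp add: le_divide_eq algebra_simps)
    next
      case 2
      then show ?thesis using le_N[OF w] by simp
    next
      case 3
      then have "(gain w - N) / (price w - 1) \<le> Sup S"
        using w by (intro cSup_upper bdd) (auto simp: S_def)
      then show ?thesis using 3 by (simp add: divide_le_eq)
    qed
  qed
qed

section \<open>Admissible densities\<close>

lemma admissible_measurable:
  assumes "w \<in> admissible u \<nu> \<mu>"
  shows "w \<in> borel_measurable \<nu>"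
    and "(\<lambda>x. extend_by_limits u (ereal (w x))) \<in> borel_measurable \<nu>"
proof -
  have "w \<in> borel_measurable \<mu>" using assms by (auto simp: admissible_def densities_def)
  then show w [measurable]: "w \<in> borel_measurable \<nu>"
    using measurable_cong_sets[OF sets_eq refl, of borel] by auto
  \<comment> \<open>A density may vanish; the dummy value 1 keeps the argument of \<open>u\<close>
    positive there.\<close>
  have [measurable]: "(\<lambda>x. u (if 0 < w x then w x else 1)) \<in> borel_measurable \<nu>"
    by (rule borel_measurable_utility[OF utility]) auto
  have "(\<lambda>x. if 0 < w x then ereal (u (if 0 < w x then w x else 1)) else extend_by_limits u 0)
      \<in> borel_measurable \<nu>" by measurable
  moreover have "0 \<le> w x" if "x \<in> space \<nu>" for x
    using assms that sets_eq_imp_space_eq[OF sets_eq] by (auto simp: admissible_def densities_def)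
  then have "(if 0 < w x then ereal (u (if 0 < w x then w x else 1)) else extend_by_limits u 0) =
      extend_by_limits u (ereal (w x))" if "x \<in> space \<nu>" for x
    using that by (force simp: extend_by_limits_ereal simp flip: zero_ereal_def)
  ultimately show "(\<lambda>x. extend_by_limits u (ereal (w x))) \<in> borel_measurable \<nu>"
    by (subst (asm) measurable_cong) auto
qed

lemma admissible_neg_part:
  assumes "w \<in> admissible u \<nu> \<mu>"
  shows "(\<integral>\<^sup>+x. e2ennreal (- extend_by_limits u (ereal (w x))) \<partial>\<nu>) < \<infinity>"
proof -
  have "e2ennreal (- a) = e2ennreal \<bar>max (- a) 0\<bar>" for a :: ereal
    by (cases a) (auto simp: e2ennreal_ereal max_def e2ennreal_neg ennreal_neg)
  then show ?thesis using assms by (simp add: admissible_def ereal_integrable_def)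
qed

text \<open>If \<open>u\<close> has a finite limit at infinity, this constant bounds the integrand,
  and \<nu> has total mass 1. Together with \<open>N_ge\<close> this puts the value in the range of
  the extended \<open>u\<close>.\<close>

lemma N_le: "N_util u \<nu> \<mu> \<le> extend_by_limits u \<infinity>"
  unfolding N_util_def
proof (rule SUP_least)
  fix w assume w: "w \<in> admissible u \<nu> \<mu>"
  have le: "extend_by_limits u (ereal (w x)) \<le> extend_by_limits u \<infinity>" if "x \<in> space \<nu>" for x
  proof -
    have "0 \<le> w x"
      using w that sets_eq_imp_space_eq[OF sets_eq] by (auto simp: admissible_def densities_def)
    then show ?thesis using extend_utility_less[OF utility, of "ereal (w x)" \<infinity>] by simp
  qed
  show "ereal_integral \<nu> (\<lambda>x. extend_by_limits u (ereal (w x))) \<le> extend_by_limits u \<infinity>"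
  proof (cases "extend_by_limits u \<infinity>")
    case (real c)
    have "ereal_integral \<nu> (\<lambda>x. extend_by_limits u (ereal (w x))) \<le>
        ereal_integral \<nu> (\<lambda>x. 0) + ereal (\<integral>x. c \<partial>\<nu>)"
    proof (rule ereal_integral_le_add)
      show "AE x in \<nu>. extend_by_limits u (ereal (w x)) \<le> 0 + ereal c"
        using le unfolding real by (intro AE_I2) simp
    qed (use admissible_measurable(2)[OF w] admissible_neg_part[OF w] in \<open>auto simp: e2ennreal_neg\<close>)
    then show ?thesis using real by (simp add: ereal_integral_def e2ennreal_neg \<nu>.prob_space)
  next
    case MInf
    then show ?thesis using extend_utility_less[OF utility, of 0 \<infinity>] by simp
  qed simp
qed

section \<open>The two inequalities between the primal and the dual value\<close>

lemma AE_dual: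
  assumes q: "\<And>n. 0 < q n" and dense: "\<And>x z. 0 < x \<Longrightarrow> x < z \<Longrightarrow> \<exists>n. x < q n \<and> q n < z"
    and "0 < c"
  shows "AE x in \<nu>. extend_by_limits (convex_dual u) (ereal c * enn2ereal (RN_deriv \<nu> \<mu> x)) =
    (SUP n. ereal (u (dual_argmax u q n (c * Z x)) - c * Z x * dual_argmax u q n (c * Z x)))"
  using AE_RN_deriv
proof eventually_elim
  case (elim x)
  then show ?case
    using SUP_dual_argmax[OF utility q dense, of "c * Z x"] Z_nonneg[of x] \<open>0 < c\<close> by simp
qed

text \<open>The values lie in the finite set of positive numbers \<open>q 0, ..., q n\<close>, whose
  minimum and maximum are the bounds.\<close>

lemma dual_argmax_bounded_plans:
  assumes q: "\<And>n. 0 < q n"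
  shows "(\<lambda>x. dual_argmax u q n (c * Z x)) \<in> bounded_plans"
proof -
  have "Min (q ` {..n}) \<le> dual_argmax u q n y" "dual_argmax u q n y \<le> Max (q ` {..n})" for y
    using dual_argmax_in[of u q n y] by (auto intro: Min_le Max_ge)
  moreover have "0 < Min (q ` {..n})" using q by simp
  moreover have "(\<lambda>x. dual_argmax u q n (c * Z x)) \<in> borel_measurable \<nu>"
    by (rule measurable_compose[OF _ borel_measurable_dual_argmax[OF utility q]]) simp
  ultimately show ?thesis unfolding bounded_plans_def by blast
qed

text \<open>Fenchel's inequality at \<open>c * Z x\<close> and \<open>w x\<close> is integrated; as
  \<open>w\<close> is a density under \<mu>, the linear term contributes exactly
  \<open>c\<close>.\<close>

lemma N_le_Delta: "N_util u \<nu> \<mu> \<le> Delta_util u \<mu> \<nu>"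
  unfolding N_util_def Delta_util_def
proof (intro SUP_least INF_greatest)
  fix w and c :: real assume w: "w \<in> admissible u \<nu> \<mu>" and c: "c \<in> {0<..}"
  obtain q :: "nat \<Rightarrow> real" where q: "\<And>n. 0 < q n"
    and dense: "\<And>x z. 0 < x \<Longrightarrow> x < z \<Longrightarrow> \<exists>n. x < q n \<and> q n < z"
    by (rule dense_positive_sequence) blast
  define W where "W n x = dual_argmax u q n (c * Z x)" for n x
  \<comment> \<open>As a countable supremum this version of the dual integrand is visibly
    measurable, and its term at index 0 is an integrable lower bound that controls the negative
    part.\<close>
  define g where "g x = (SUP n. ereal (u (W n x) - c * Z x * W n x))" for x
  have W: "W n \<in> bounded_plans" for n
    using dual_argmax_bounded_plans[OF q] by (simp add: W_def[abs_def])
  have [measurable]: "W n \<in> borel_measurable \<nu>" "(\<lambda>x. u (W n x)) \<in> borel_measurable \<nu>" for n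
    using bounded_plans_measurable[OF W] integrable_gain[OF W] by auto
  have g [measurable]: "g \<in> borel_measurable \<nu>" unfolding g_def by measurable
  have g_eq: "g x = extend_by_limits (convex_dual u) (ereal (c * Z x))" for x
    unfolding g_def W_def using c Z_nonneg[of x]
    by (intro SUP_dual_argmax[OF utility q dense]) auto
  have "(\<integral>\<^sup>+x. e2ennreal (- g x) \<partial>\<nu>) \<le> (\<integral>\<^sup>+x. ennreal (- (u (W 0 x) - c * (Z x * W 0 x))) \<partial>\<nu>)"
  proof (rule nn_integral_mono)
    fix x
    have "ereal (u (W 0 x) - c * Z x * W 0 x) \<le> g x" unfolding g_def by (rule SUP_upper) simp
    then show "e2ennreal (- g x) \<le> ennreal (- (u (W 0 x) - c * (Z x * W 0 x)))"
      by (cases "g x") (auto simp: e2ennreal_ereal e2ennreal_neg mult.assoc intro!: ennreal_leI)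
  qed
  also have "\<dots> < \<infinity>"
    using integrable_gain[OF W] integrable_price[OF W] by (intro nn_integral_ennreal_less_top) auto
  finally have neg: "(\<integral>\<^sup>+x. e2ennreal (- g x) \<partial>\<nu>) < \<infinity>" .
  have wd: "integrable \<mu> w" "(\<integral>x. w x \<partial>\<mu>) = 1" "\<And>x. x \<in> space \<nu> \<Longrightarrow> 0 \<le> w x"
    using w sets_eq_imp_space_eq[OF sets_eq] by (auto simp: admissible_def densities_def)
  have Zw: "integrable \<nu> (\<lambda>x. Z x * w x)" "(\<integral>x. Z x * w x \<partial>\<nu>) = 1"
    using wd integrable_Z_iff[OF admissible_measurable(1)[OF w]]
      integral_Z[OF admissible_measurable(1)[OF w]] by auto
  have "ereal_integral \<nu> (\<lambda>x. extend_by_limits u (ereal (w x))) \<le>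
      ereal_integral \<nu> g + ereal (\<integral>x. c * (Z x * w x) \<partial>\<nu>)"
  proof (rule ereal_integral_le_add)
    show "AE x in \<nu>. extend_by_limits u (ereal (w x)) \<le> g x + ereal (c * (Z x * w x))"
    proof (rule AE_I2)
      fix x assume "x \<in> space \<nu>"
      then show "extend_by_limits u (ereal (w x)) \<le> g x + ereal (c * (Z x * w x))"
        using fenchel_inequality[OF utility, of "c * Z x" "w x"] c Z_nonneg[of x] wd(3)
        by (simp add: g_eq mult.assoc)
    qed
  qed (use admissible_measurable[OF w] admissible_neg_part[OF w] neg Zw in auto)
  also have "\<dots> = ereal c + ereal_integral \<nu> g" using Zw by (simp add: add.commute)
  also have "ereal_integral \<nu> g = ereal_integral \<nu>
      (\<lambda>x. extend_by_limits (convex_dual u) (ereal c * enn2ereal (RN_deriv \<nu> \<mu> x)))"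
    using AE_dual[OF q dense, of c] c
    by (intro ereal_integral_cong_AE) (auto simp: g_def W_def elim!: eventually_mono)
  finally show "ereal_integral \<nu> (\<lambda>x. extend_by_limits u (ereal (w x))) \<le> ereal c +
      ereal_integral \<nu> (\<lambda>x. extend_by_limits (convex_dual u) (ereal c * enn2ereal (RN_deriv \<nu> \<mu> x)))" .
qed

lemma Delta_le_N: "Delta_util u \<mu> \<nu> \<le> N_util u \<nu> \<mu>"
proof (cases "N_util u \<nu> \<mu>")
  case (real N)
  obtain L where L: "0 \<le> L" "\<And>w. w \<in> bounded_plans \<Longrightarrow> gain w - N \<le> L * (price w - 1)"
    using supporting_slope[OF real] by blast
  obtain q :: "nat \<Rightarrow> real" where q: "\<And>n. 0 < q n"
    and dense: "\<And>x z. 0 < x \<Longrightarrow> x < z \<Longrightarrow> \<exists>n. x < q n \<and> q n < z"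
    by (rule dense_positive_sequence) blast
  show ?thesis
  proof (rule ereal_le_epsilon2)
    fix e :: real assume e: "0 < e"
    \<comment> \<open>The slope \<open>L\<close> may be 0, whereas the infimum runs over positive
      multipliers.\<close>
    define c where "c = L + e"
    have c: "0 < c" using L e by (simp add: c_def)
    define W where "W n x = dual_argmax u q n (c * Z x)" for n x
    have W: "W n \<in> bounded_plans" for n
      using dual_argmax_bounded_plans[OF q] by (simp add: W_def[abs_def])
    have "ereal_integral \<nu>
        (\<lambda>x. extend_by_limits (convex_dual u) (ereal c * enn2ereal (RN_deriv \<nu> \<mu> x))) =
      ereal_integral \<nu> (\<lambda>x. SUP n. ereal (u (W n x) - c * Z x * W n x))"
      unfolding W_def by (rule ereal_integral_cong_AE[OF AE_dual[OF q dense c]])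
    also have "\<dots> \<le> ereal (N - L)"
    proof (rule ereal_integral_SUP_le)
      fix n
      show "integrable \<nu> (\<lambda>x. u (W n x) - c * Z x * W n x)"
        using integrable_gain[OF W] integrable_price[OF W] by (simp add: mult.assoc)
      have "(\<integral>x. u (W n x) - c * Z x * W n x \<partial>\<nu>) = gain (W n) - c * price (W n)"
        using integrable_gain[OF W] integrable_price[OF W]
        by (simp add: mult.assoc gain_def price_def)
      \<comment> \<open>The supporting line bounds \<open>gain - L * price\<close> by
        \<open>N - L\<close>. The excess \<open>e\<close> of the multiplier only subtracts a
        nonnegative amount.\<close>
      also have "\<dots> \<le> N - L - e * price (W n)"
        using L(2)[OF W, of n] by (simp add: c_def algebra_simps)
      also have "\<dots> \<le> N - L"
      proof -
        have "0 \<le> price (W n)" unfolding price_def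
          using bounded_plans_pos[OF W] Z_nonneg
          by (intro Bochner_Integration.integral_nonneg) (auto intro: mult_nonneg_nonneg less_imp_le)
        then show ?thesis using e by simp
      qed
      finally show "(\<integral>x. u (W n x) - c * Z x * W n x \<partial>\<nu>) \<le> N - L" .
    qed (simp add: W_def dual_argmax_mono)
    finally have "ereal c + ereal_integral \<nu>
        (\<lambda>x. extend_by_limits (convex_dual u) (ereal c * enn2ereal (RN_deriv \<nu> \<mu> x)))
      \<le> ereal c + ereal (N - L)"
      by (rule add_left_mono)
    then have "Delta_util u \<mu> \<nu> \<le> ereal c + ereal (N - L)"
      unfolding Delta_util_def using c by (intro INF_lower2[of c]) auto
    then show "Delta_util u \<mu> \<nu> \<le> N_util u \<nu> \<mu> + ereal e"
      by (simp add: real c_def add.commute)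
  qed
next
  case MInf
  then show ?thesis using N_ge by simp
qed simp

end

theorem proposition4p15:
  fixes u :: "real \<Rightarrow> real" and \<mu> \<nu> :: "'a measure"
  assumes "utility_function u"
    and "reasonable_asymptotic_elasticity u"
    and "prob_space \<mu>" and "prob_space \<nu>"
    and "sets \<mu> = sets \<nu>"
    and "absolutely_continuous \<nu> \<mu>"
  shows "Delta_util u \<mu> \<nu> = N_util u \<nu> \<mu> \<and>
         delta_util u \<mu> \<nu> = exp_ereal (H_util u \<nu> \<mu>) - 1"
proof -
  interpret utility_pair \<mu> \<nu> u
    using assms by (auto simp: utility_pair_def utility_pair_axioms_def)
  have "Delta_util u \<mu> \<nu> = N_util u \<nu> \<mu>"
    by (rule antisym[OF Delta_le_N N_le_Delta])
  \<comment> \<open>On nonnegative values \<open>exp_ereal\<close> undoes \<open>ln_ereal\<close>,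
    which turns the first identity into the second.\<close>
  moreover have "0 \<le> utility_inverse u (N_util u \<nu> \<mu>)"
    by (rule utility_inverse_nonneg[OF utility N_ge N_le])
  ultimately show ?thesis
    by (simp add: delta_util_def H_util_def exp_ln_ereal)
qed

end
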